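(* Let $0<\gamma_1<1$, $0<\gamma_2<1$, $\gamma=(\gamma_1,\gamma_2)$, and let $M:[0,1]\times[0,1]\to\mathbb{R}$ be the function constructed in the context. Then $\mathcal{I}^{\gamma}M(x,y)$ is finite on $[0,1]\times[0,1]$ and $$\dim_H \mathrm{Gr}(\mathcal{I}^{\gamma}M)=\dim_B \mathrm{Gr}(\mathcal{I}^{\gamma}M)=2,$$ where the graph is taken over $[0,1]\times[0,1]$.
   Context: Construction of $M$. Let $a_0=0$ and $a_n=\frac12+\frac1{2^2}+\dots+\frac1{2^n}$ for $n\in\mathbb{N}$, so $a_n\uparrow1$. Let $\Theta(x,y)=x(x-0.5)y$ on $[0,0.5]\times[0,1]$, so $\Theta(0,y)=\Theta(0.5,y)$ for all $y\in[0,1]$. For $n\ge1$ let $\Upsilon_n:[a_{n-1},a_n]\to[0,0.5]$ be $\Upsilon_n(x)=2^{n-1}(x-a_{n-1})$. Let $G_1(x,y)=\Theta(x,y)$ for $(x,y)\in[0,0.5]\times[0,1]$, and for $n\ge2$ $$G_n(x,y)=\frac1n\Theta(\Upsilon_n(x),y)+\frac{n-1}{n}\Theta(0,y),\qquad (x,y)\in[a_{n-1},a_n]\times[0,1].$$ Let $F_n$ be the function on $[0,a_n]\times[0,1]$ obtained by gluing together $G_1,\dots,G_n$, and let $M(x,y)=\lim_{n\to\infty}F_n(x,y)$; that is, $M=G_n$ on $[a_{n-1},a_n]\times[0,1]$ for every $n\ge1$, extended continuously to $x=1$ by $M(1,y)=\Theta(0,y)=0$. The mixed Riemann-Liouville fractional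 integral of $f$ on $[0,1]\times[0,1]$ is $$\mathcal{I}^{\gamma}f(x,y)=\frac{1}{\Gamma(\gamma_1)\Gamma(\gamma_2)}\int_0^x\int_0^y (x-u)^{\gamma_1-1}(y-v)^{\gamma_2-1}f(u,v)\,du\,dv .$$ $\mathrm{Gr}(g)=\{(x,y,g(x,y)):(x,y)\in[0,1]\times[0,1]\}\subset\mathbb{R}^3$ is the graph of $g$. $\dim_H$ is the Hausdorff dimension. For a nonempty bounded set $E\subset\mathbb{R}^n$, $N_\delta(E)$ is the smallest number of sets of diameter at most $\delta$ that cover $E$, and $\dim_B(E)=\lim_{\delta\to0}\frac{\log N_\delta(E)}{-\log\delta}$ is the box dimension; an assertion $\dim_B(E)=s$ includes that the limit exists. *)

theory Defs
  imports "HOL-Analysis.Analysis"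
begin

section \<open>Hausdorff dimension\<close>

text \<open>
  The contribution of a covering set is \<open>(diam U)\<^sup>s\<close> with the usual convention that
  \<open>(diam U)\<^sup>0 = 1\<close> for nonempty \<open>U\<close> (note that \<open>0 powr 0 = 0\<close> in HOL).  Boundedness of covering sets
  is required explicitly because \<^const>\<open>diameter\<close> is only meaningful for bounded sets.
\<close>

definition diam_pow :: "real \<Rightarrow> 'a::metric_space set \<Rightarrow> ennreal" where
  "diam_pow s U =
     (if U = {} then 0 else if s = 0 then 1 else ennreal (diameter U powr s))"

definition delta_cover :: "real \<Rightarrow> 'a::metric_space set \<Rightarrow> (nat \<Rightarrow> 'a set) \<Rightarrow> bool" where
  "delta_cover \<delta> E U \<longleftrightarrow>
     E \<subseteq> (\<Union>i. U i) \<and> (\<forall>i. bounded (U i) \<and> diameter (U i) \<le> \<delta>)"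

definition hausdorff_pre_measure :: "real \<Rightarrow> real \<Rightarrow> 'a::metric_space set \<Rightarrow> ennreal" where
  "hausdorff_pre_measure s \<delta> E = (INF U\<in>{U. delta_cover \<delta> E U}. \<Sum>i. diam_pow s (U i))"

definition hausdorff_measure :: "real \<Rightarrow> 'a::metric_space set \<Rightarrow> ennreal" where
  "hausdorff_measure s E = (SUP \<delta>\<in>{0<..}. hausdorff_pre_measure s \<delta> E)"

definition hausdorff_dim :: "'a::metric_space set \<Rightarrow> ennreal" where
  "hausdorff_dim E = (INF s\<in>{s. 0 \<le> s \<and> hausdorff_measure s E = 0}. ennreal s)"


section \<open>Box dimension\<close>

definition covering_number :: "real \<Rightarrow> 'a::metric_space set \<Rightarrow> nat" where
  "covering_number \<delta> E =
     (LEAST n. \<exists>\<C>. finite \<C> \<and> card \<C> = n \<and> E \<subseteq> \<Union>\<C> \<and>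
                    (\<forall>U\<in>\<C>. bounded U \<and> diameter U \<le> \<delta>))"

text \<open>
  A relation rather than a function, so that existence of the limit is part of the assertion.
\<close>

definition has_box_dim :: "'a::metric_space set \<Rightarrow> real \<Rightarrow> bool" where
  "has_box_dim E s \<longleftrightarrow> E \<noteq> {} \<and> bounded E \<and>
     ((\<lambda>\<delta>. ln (real (covering_number \<delta> E)) / (- ln \<delta>)) \<longlongrightarrow> s) (at_right 0)"


section \<open>Graphs over the unit square\<close>

text \<open>
  The metric of \<^typ>\<open>real \<times> real \<times> real\<close> is the Euclidean metric of three-dimensional space.
\<close>

definition Gr :: "(real \<Rightarrow> real \<Rightarrow> real) \<Rightarrow> (real \<times> real \<times> real) set" where
  "Gr g = {(x, y, g x y) | x y. x \<in> {0..1} \<and> y \<in> {0..1}}"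


section \<open>The mixed Riemann-Liouville fractional integral\<close>

definition RL_integrand ::
    "real \<Rightarrow> real \<Rightarrow> (real \<Rightarrow> real \<Rightarrow> real) \<Rightarrow> real \<Rightarrow> real \<Rightarrow> real \<times> real \<Rightarrow> real" where
  "RL_integrand \<gamma>1 \<gamma>2 f x y =
     (\<lambda>(u, v). (x - u) powr (\<gamma>1 - 1) * (y - v) powr (\<gamma>2 - 1) * f u v)"

text \<open>
  The Lebesgue integral in HOL is total (it is \<open>0\<close> for non-integrable functions), so finiteness of
  the fractional integral at a point is stated separately.
\<close>

definition mixed_RL_finite ::
    "real \<Rightarrow> real \<Rightarrow> (real \<Rightarrow> real \<Rightarrow> real) \<Rightarrow> real \<Rightarrow> real \<Rightarrow> bool" where
  "mixed_RL_finite \<gamma>1 \<gamma>2 f x y \<longleftrightarrow>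
     set_integrable lborel ({0..x} \<times> {0..y}) (RL_integrand \<gamma>1 \<gamma>2 f x y)"

definition mixed_RL ::
    "real \<Rightarrow> real \<Rightarrow> (real \<Rightarrow> real \<Rightarrow> real) \<Rightarrow> real \<Rightarrow> real \<Rightarrow> real" where
  "mixed_RL \<gamma>1 \<gamma>2 f x y =
     1 / (Gamma \<gamma>1 * Gamma \<gamma>2) *
     (LINT p:{0..x} \<times> {0..y} | lborel. RL_integrand \<gamma>1 \<gamma>2 f x y p)"


section \<open>The function M\<close>

definition a_seq :: "nat \<Rightarrow> real" where
  "a_seq n = (\<Sum>k=1..n. 1 / 2 ^ k)"

definition Theta :: "real \<Rightarrow> real \<Rightarrow> real" where
  "Theta x y = x * (x - 1/2) * y"

definition Upsilon :: "nat \<Rightarrow> real \<Rightarrow> real" where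
  "Upsilon n x = 2 ^ (n - 1) * (x - a_seq (n - 1))"

definition G_piece :: "nat \<Rightarrow> real \<Rightarrow> real \<Rightarrow> real" where
  "G_piece n x y =
     (if n = 1 then Theta x y
      else 1 / real n * Theta (Upsilon n x) y + (real n - 1) / real n * Theta 0 y)"

text \<open>
  \<open>F_glued n\<close> is the gluing of \<open>G_piece 1, \<dots>, G_piece n\<close> on \<open>[0, a_seq n] \<times> [0, 1]\<close>, for \<open>n \<ge> 1\<close>;
  its values elsewhere, and \<open>F_glued 0\<close>, are irrelevant.
\<close>

fun F_glued :: "nat \<Rightarrow> real \<Rightarrow> real \<Rightarrow> real" where
  "F_glued 0 x y = 0"
| "F_glued (Suc 0) x y = G_piece 1 x y"
| "F_glued (Suc (Suc n)) x y =
     (if x \<le> a_seq (Suc n) then F_glued (Suc n) x y else G_piece (Suc (Suc n)) x y)"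

definition M_fun :: "real \<Rightarrow> real \<Rightarrow> real" where
  "M_fun x y = (if x = 1 then Theta 0 y else lim (\<lambda>n. F_glued n x y))"

text \<open>The pieces agree on common boundaries, and \<open>M_fun\<close> restricts to \<open>G_piece n\<close> on the \<open>n\<close>-th strip.\<close>

lemma a_seq_Suc: "a_seq (Suc n) = a_seq n + 1 / 2 ^ Suc n"
  by (simp add: a_seq_def)

lemma a_seq_eq: "a_seq n = 1 - 1 / 2 ^ n"
  by (induction n) (auto simp: a_seq_Suc, simp add: a_seq_def)

lemma a_seq_mono: "m \<le> n \<Longrightarrow> a_seq m \<le> a_seq n"
  by (simp add: a_seq_eq frac_le)

lemma G_piece_right: "n \<ge> 1 \<Longrightarrow> G_piece n (a_seq n) y = 0"
  by (cases n) (auto simp: G_piece_def Theta_def Upsilon_def a_seq_eq field_simps)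

lemma G_piece_left: "n \<ge> 1 \<Longrightarrow> G_piece n (a_seq (n - 1)) y = 0"
  by (auto simp: G_piece_def Theta_def Upsilon_def a_seq_eq)

lemma F_glued_eq:
  assumes "1 \<le> k" "k \<le> n" "a_seq (k - 1) \<le> x" "x \<le> a_seq k"
  shows "F_glued n x y = G_piece k x y"
  using assms
proof (induction n arbitrary: k)
  case (Suc n)
  show ?case
  proof (cases n)
    case 0
    then show ?thesis using Suc.prems by (simp add: le_Suc_eq)
  next
    case (Suc m)
    show ?thesis
    proof (cases "k \<le> n")
      case True
      then show ?thesis using Suc Suc.IH[of k] Suc.prems a_seq_mono[OF True] by auto
    next
      case False
      hence k: "k = Suc n" using Suc.prems by simp
      have "F_glued n x y = G_piece k x y" if "x \<le> a_seq n"
      proof -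
        have x: "x = a_seq n" using Suc.prems k that by simp
        have "F_glued n x y = G_piece n x y"
          using Suc.IH[of n] Suc a_seq_mono[of "n - 1" n] x by simp
        then show ?thesis
          using G_piece_right[of n y] G_piece_left[of k y] k x Suc by simp
      qed
      then show ?thesis using k Suc by auto
    qed
  qed
qed simp

lemma M_fun_eq:
  assumes "1 \<le> n" "a_seq (n - 1) \<le> x" "x \<le> a_seq n"
  shows "M_fun x y = G_piece n x y"
proof -
  have "a_seq n < 1" by (simp add: a_seq_eq)
  hence "x \<noteq> 1" using assms(3) by linarith
  have "\<forall>\<^sub>F m in sequentially. F_glued m x y = G_piece n x y"
    using F_glued_eq[OF assms(1) _ assms(2,3)] eventually_sequentially by blast
  hence "(\<lambda>m. F_glued m x y) \<longlonglongrightarrow> G_piece n x y"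
    by (rule tendsto_eventually)
  with \<open>x \<noteq> 1\<close> show ?thesis by (simp add: M_fun_def limI)
qed

lemma M_fun_1: "M_fun 1 y = 0"
  by (simp add: M_fun_def Theta_def)

end

theory Submission
  imports Defs "HOL-Real_Asymp.Real_Asymp"
begin

text \<open>
  The fractional integral \<open>F\<close> of \<open>M\<close> is locally Lipschitz away from the line \<open>x = 1\<close>, where \<open>M\<close>
  oscillates so fast that its total variation diverges.  The reason why its graph still has dimension
  \<open>2\<close> is that this divergence is at most logarithmic in the scale.

  After the substitution \<open>(u, v) = (x - s, y - t)\<close> the integral becomes a convolution with the fixed
  integrable kernel \<open>s powr (\<gamma>1 - 1) * t powr (\<gamma>2 - 1)\<close> on the unit square
  (\<open>RL_as_convolution\<close>).  Because \<open>M\<close> vanishes on both axes, it may be continued by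
  \<open>M (max 0 u) (max 0 v)\<close> without changing the integral.  Hence \<open>F\<close> inherits, up to one constant,
  every bound and every Lipschitz estimate of \<open>M\<close> (\<open>mixed_RL_Lipschitz\<close>).  On
  \<open>[0, a_seq n] \<times> [0, 1]\<close> the function \<open>M\<close> is \<open>2 ^ n\<close>-Lipschitz in \<open>x\<close> and \<open>1\<close>-Lipschitz in \<open>y\<close>.
  The strip between \<open>a_seq n\<close> and \<open>a_seq (Suc n)\<close> has width \<open>1 / 2 ^ Suc n\<close>; stretching it in \<open>x\<close> to width
  \<open>1\<close> cancels the growth of the Lipschitz constant.  The graph of \<open>F\<close> over each strip is therefore a
  Lipschitz image of the unit square with a constant that does not depend on the strip, and is covered
  by \<open>(m + 1)\<^sup>2\<close> sets of diameter of order \<open>1 / m\<close>.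

  At scale \<open>1 / 2 ^ n\<close>, the first \<open>n\<close> strips are covered in this way with \<open>m = 2 ^ n\<close>.  What remains is
  thinner than the scale and bounded in the other two directions, so it costs no more than one
  strip (\<open>graph_covered_by\<close>).  Altogether about \<open>n * 4 ^ n\<close> sets suffice; the factor \<open>n\<close> is
  logarithmic in the scale and disappears in the limit, so the upper box dimension is at most \<open>2\<close>.
  In the other direction, a graph over the unit square projects onto the square, and comparing areas
  bounds \<open>\<Sum>i. (diam (U i))\<^sup>2\<close> from below for every cover \<open>U\<close>
  (\<open>area_le_diam_sum\<close>).  This makes the lower box dimension and the Hausdorff dimension at least \<open>2\<close>; the
  Hausdorff dimension never exceeds the box dimension.
\<close>

section \<open>Finite covers by small sets\<close>

definition covered_by :: "nat \<Rightarrow> real \<Rightarrow> 'a::metric_space set \<Rightarrow> bool" where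
  "covered_by N \<delta> E \<longleftrightarrow>
     (\<exists>\<C>. finite \<C> \<and> card \<C> \<le> N \<and> E \<subseteq> \<Union>\<C> \<and> (\<forall>U\<in>\<C>. bounded U \<and> diameter U \<le> \<delta>))"

lemma covered_by_empty: "covered_by 0 \<delta> {}"
  unfolding covered_by_def by (rule exI[of _ "{}"]) auto

lemma covered_by_Un:
  assumes "covered_by m \<delta> E" "covered_by n \<delta> F"
  shows "covered_by (m + n) \<delta> (E \<union> F)"
proof -
  obtain \<C> \<D> where
    "finite \<C>" "card \<C> \<le> m" "E \<subseteq> \<Union>\<C>" "\<forall>U\<in>\<C>. bounded U \<and> diameter U \<le> \<delta>"
    "finite \<D>" "card \<D> \<le> n" "F \<subseteq> \<Union>\<D>" "\<forall>U\<in>\<D>. bounded U \<and> diameter U \<le> \<delta>"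
    using assms unfolding covered_by_def by metis
  moreover from this have "card (\<C> \<union> \<D>) \<le> m + n"
    using card_Un_le[of \<C> \<D>] by linarith
  ultimately show ?thesis
    unfolding covered_by_def by (intro exI[of _ "\<C> \<union> \<D>"]) auto
qed

lemma covered_by_mono:
  assumes "covered_by m \<delta> E" "m \<le> n" "\<delta> \<le> \<epsilon>" "F \<subseteq> E"
  shows "covered_by n \<epsilon> F"
  using assms unfolding covered_by_def by (meson order_trans)

lemma covering_number_le:
  assumes "covered_by N \<delta> E"
  shows "covering_number \<delta> E \<le> N"
proof -
  obtain \<C> where "finite \<C>" "card \<C> \<le> N" "E \<subseteq> \<Union>\<C>" "\<forall>U\<in>\<C>. bounded U \<and> diameter U \<le> \<delta>"
    using assms unfolding covered_by_def by blast
  then have "covering_number \<delta> E \<le> card \<C>"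
    unfolding covering_number_def by (intro Least_le) blast
  with \<open>card \<C> \<le> N\<close> show ?thesis by simp
qed

lemma covered_by_covering_number:
  assumes "covered_by N \<delta> E"
  shows "covered_by (covering_number \<delta> E) \<delta> E"
proof -
  let ?P = "\<lambda>n. \<exists>\<C>. finite \<C> \<and> card \<C> = n \<and> E \<subseteq> \<Union>\<C> \<and> (\<forall>U\<in>\<C>. bounded U \<and> diameter U \<le> \<delta>)"
  have "\<exists>n. ?P n" using assms unfolding covered_by_def by blast
  then have "?P (covering_number \<delta> E)"
    unfolding covering_number_def by (rule LeastI_ex)
  then show ?thesis unfolding covered_by_def by auto
qed

lemma bounded_diameter_le:
  fixes S :: "'a::metric_space set"
  assumes "\<And>x y. x \<in> S \<Longrightarrow> y \<in> S \<Longrightarrow> dist x y \<le> d" "0 \<le> d"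
  shows "bounded S" "diameter S \<le> d"
  using assms by (auto simp: bounded_two_points diameter_def intro!: cSUP_least)

lemma bounded_covered_by:
  fixes E :: "'a::heine_borel set"
  assumes "bounded E" "0 < \<delta>"
  shows "\<exists>N. covered_by N \<delta> E"
proof -
  have "compact (closure E)" using assms(1) by (simp add: compact_closure)
  then obtain T where T: "T \<subseteq> closure E" "finite T" "closure E \<subseteq> (\<Union>x\<in>T. ball x (\<delta>/2))"
    by (rule compactE_image[where C = "closure E" and f = "\<lambda>x. ball x (\<delta>/2)"]) (use assms(2) in auto)
  have "diameter (ball x (\<delta>/2)) \<le> \<delta>" for x :: 'a
  proof (rule bounded_diameter_le)
    fix y z assume "y \<in> ball x (\<delta>/2)" "z \<in> ball x (\<delta>/2)"
    then show "dist y z \<le> \<delta>" using dist_triangle_half_r[of x y \<delta> z] by simp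
  qed (use assms(2) in simp)
  then show ?thesis
    unfolding covered_by_def using T closure_subset[of E]
    by (intro exI[of _ "card ((\<lambda>x. ball x (\<delta>/2)) ` T)"] exI[of _ "(\<lambda>x. ball x (\<delta>/2)) ` T"]) auto
qed

text \<open>
  The map \<open>p\<close> reads off parameters in the unit square; the cover consists of the preimages of the
  cells of the grid of mesh \<open>1 / m\<close>.  The slack \<open>1 / m\<close> in the distance bound admits sets that are
  only close to a surface, at the scale of the grid.
\<close>

lemma covered_by_grid:
  fixes p :: "'a::metric_space \<Rightarrow> real \<times> real"
  assumes p: "p ` E \<subseteq> {0..1} \<times> {0..1}" and m: "0 < m" and D: "0 \<le> D"
    and dist: "\<And>e e'. e \<in> E \<Longrightarrow> e' \<in> E \<Longrightarrow>
      dist e e' \<le> D * (\<bar>fst (p e) - fst (p e')\<bar> + \<bar>snd (p e) - snd (p e')\<bar> + 1 / real m)"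
  shows "covered_by ((m + 1)\<^sup>2) (3 * D / real m) E"
proof -
  define cell where "cell e = (\<lfloor>real m * fst (p e)\<rfloor>, \<lfloor>real m * snd (p e)\<rfloor>)" for e
  define S where "S = {0..int m} \<times> {0..int m}"
  define U where "U c = {e \<in> E. cell e = c}" for c
  have fl: "\<bar>s - t\<bar> \<le> 1 / real m" if "\<lfloor>real m * s\<rfloor> = \<lfloor>real m * t\<rfloor>" for s t
  proof -
    have "\<bar>real m * s - real m * t\<bar> \<le> 1" using that by linarith
    then have "real m * \<bar>s - t\<bar> \<le> 1" by (simp add: abs_mult flip: right_diff_distrib)
    then show ?thesis using m by (simp add: pos_le_divide_eq mult.commute)
  qed
  have *: "dist e e' \<le> 3 * D / real m" if "e \<in> U c" "e' \<in> U c" for e e' c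
  proof -
    have "dist e e' \<le> D * (\<bar>fst (p e) - fst (p e')\<bar> + \<bar>snd (p e) - snd (p e')\<bar> + 1 / real m)"
      using that dist by (auto simp: U_def)
    also have "\<dots> \<le> D * (1 / real m + 1 / real m + 1 / real m)"
      using that D fl by (intro mult_left_mono add_mono) (auto simp: U_def cell_def)
    finally show ?thesis by (simp add: mult.commute)
  qed
  have "cell e \<in> S" if "e \<in> E" for e
  proof -
    have "fst (p e) \<in> {0..1}" "snd (p e) \<in> {0..1}" using p that by (auto simp: mem_Times_iff)
    then have "0 \<le> real m * fst (p e)" "real m * fst (p e) \<le> real m"
      "0 \<le> real m * snd (p e)" "real m * snd (p e) \<le> real m"
      by (auto simp: mult_left_le)
    then show ?thesis unfolding cell_def S_def by (auto simp: floor_le_iff)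
  qed
  then have "E \<subseteq> \<Union>(U ` S)" by (auto simp: U_def)
  moreover have "card (U ` S) \<le> (m + 1)\<^sup>2"
    using card_image_le[of S U] by (simp add: S_def card_cartesian_product power2_eq_square nat_add_distrib)
  moreover have "bounded (U c)" "diameter (U c) \<le> 3 * D / real m" for c
    using bounded_diameter_le[of "U c" "3 * D / real m"] * D by simp_all
  ultimately show ?thesis
    unfolding covered_by_def by (intro exI[of _ "U ` S"]) (auto simp: S_def)
qed

section \<open>Hausdorff measure and box dimension\<close>

text \<open>
  Counting a finite cover is a special case of a countable one, padded by empty sets, which
  contribute nothing.  This one comparison is used in both directions: with a good cover it bounds
  the Hausdorff measure from above, and with a lower bound for the premeasure it bounds covering
  numbers from below.
\<close>

lemma hausdorff_pre_measure_le_covered: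
  assumes "covered_by N \<delta> E" "0 < s" "0 \<le> \<delta>"
  shows "hausdorff_pre_measure s \<delta> E \<le> ennreal (real N * \<delta> powr s)"
proof -
  obtain \<C> where \<C>: "finite \<C>" "card \<C> \<le> N" "E \<subseteq> \<Union>\<C>" "\<And>U. U \<in> \<C> \<Longrightarrow> bounded U \<and> diameter U \<le> \<delta>"
    using assms(1) unfolding covered_by_def by blast
  obtain f where f: "bij_betw f {..<card \<C>} \<C>"
    using ex_bij_betw_nat_finite[OF \<C>(1)] by (auto simp: atLeast0LessThan)
  define U where "U i = (if i < card \<C> then f i else {})" for i
  have fC: "f i \<in> \<C>" if "i < card \<C>" for i
    using f that by (auto simp: bij_betw_def)
  have "\<Union>\<C> = (\<Union>i<card \<C>. f i)" using f by (auto simp: bij_betw_def)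
  also have "\<dots> \<subseteq> (\<Union>i. U i)" by (auto simp: U_def split: if_splits)
  finally have "delta_cover \<delta> E U"
    using \<C> fC assms(3) by (auto simp: delta_cover_def U_def)
  then have "hausdorff_pre_measure s \<delta> E \<le> (\<Sum>i. diam_pow s (U i))"
    unfolding hausdorff_pre_measure_def by (intro INF_lower) simp
  also have "\<dots> = (\<Sum>i<card \<C>. diam_pow s (U i))"
    by (rule suminf_finite) (auto simp: U_def diam_pow_def)
  also have "\<dots> \<le> (\<Sum>i<card \<C>. ennreal (\<delta> powr s))"
    using \<C>(4) fC assms
    by (intro sum_mono) (auto simp: U_def diam_pow_def intro!: ennreal_leI powr_mono2 diameter_ge_0)
  also have "\<dots> = ennreal (real (card \<C>) * \<delta> powr s)"
    by (simp add: ennreal_mult' ennreal_of_nat_eq_real_of_nat)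
  also have "\<dots> \<le> ennreal (real N * \<delta> powr s)"
    using \<C>(2) by (intro ennreal_leI mult_right_mono) auto
  finally show ?thesis .
qed

lemma hausdorff_pre_measure_antimono_scale:
  assumes "\<delta> \<le> \<epsilon>"
  shows "hausdorff_pre_measure s \<epsilon> E \<le> hausdorff_pre_measure s \<delta> E"
  unfolding hausdorff_pre_measure_def
  using assms by (intro INF_superset_mono) (auto simp: delta_cover_def order_trans[OF _ assms])

lemma hausdorff_pre_measure_antimono_exponent:
  assumes "0 \<le> s" "s \<le> t" "\<delta> \<le> 1"
  shows "hausdorff_pre_measure t \<delta> E \<le> hausdorff_pre_measure s \<delta> E"
  unfolding hausdorff_pre_measure_def
proof (rule INF_mono)
  fix U assume "U \<in> {U. delta_cover \<delta> E U}"
  then have U: "bounded (U i)" "diameter (U i) \<le> 1" for i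
    using assms(3) by (auto simp: delta_cover_def intro: order_trans)
  have "diam_pow t (U i) \<le> diam_pow s (U i)" for i
  proof -
    have "0 \<le> diameter (U i)" using U(1) by (rule diameter_ge_0)
    then show ?thesis
      using assms U(2)[of i] by (auto simp: diam_pow_def powr_le1 intro!: ennreal_leI powr_mono')
  qed
  then have "(\<Sum>i. diam_pow t (U i)) \<le> (\<Sum>i. diam_pow s (U i))"
    by (intro suminf_le) auto
  with \<open>U \<in> _\<close> show "\<exists>V\<in>{U. delta_cover \<delta> E U}. (\<Sum>i. diam_pow t (V i)) \<le> (\<Sum>i. diam_pow s (U i))"
    by blast
qed

text \<open>
  If \<open>d < d + e/2 < s = d + e\<close>, then at small scales there are covers by at most
  \<open>\<delta> powr (- (d + e/2))\<close> sets, and their \<open>s\<close>-dimensional sum is at most \<open>\<delta> powr (e/2)\<close>,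
  which tends to \<open>0\<close>.
\<close>

lemma hausdorff_dim_le_box_dim:
  fixes E :: "'a::heine_borel set"
  assumes E: "has_box_dim E d" and d: "0 \<le> d"
  shows "hausdorff_dim E \<le> ennreal d"
proof (rule ennreal_le_epsilon)
  fix e :: real assume e: "0 < e"
  define s where "s = d + e"
  have s: "0 < s" using e d by (simp add: s_def)
  have pre: "hausdorff_pre_measure s \<epsilon> E = 0" if \<epsilon>: "0 < \<epsilon>" for \<epsilon>
  proof -
    have lim: "((\<lambda>\<delta>. ennreal (\<delta> powr (e/2))) \<longlongrightarrow> ennreal 0) (at_right 0)"
      using e by (intro tendsto_ennrealI) real_asymp
    have "\<forall>\<^sub>F \<delta> in at_right 0. ln (real (covering_number \<delta> E)) / (- ln \<delta>) < d + e/2"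
      using E e unfolding has_box_dim_def by (intro order_tendstoD(2)) auto
    moreover have "\<forall>\<^sub>F \<delta> in at_right (0::real). \<delta> \<in> {0<..<min 1 \<epsilon>}"
      using \<epsilon> by (intro eventually_at_right_real) simp
    ultimately have "\<forall>\<^sub>F \<delta> in at_right 0. hausdorff_pre_measure s \<epsilon> E \<le> ennreal (\<delta> powr (e/2))"
    proof eventually_elim
      case (elim \<delta>)
      then have \<delta>: "0 < \<delta>" "\<delta> < 1" "\<delta> < \<epsilon>" by auto
      let ?N = "covering_number \<delta> E"
      have cov: "covered_by ?N \<delta> E"
        using bounded_covered_by[of E \<delta>] E \<delta> covered_by_covering_number by (auto simp: has_box_dim_def)
      have "real ?N \<le> \<delta> powr (- (d + e/2))"
      proof (cases "?N = 0")
        case False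
        have "ln (real ?N) \<le> (d + e/2) * (- ln \<delta>)"
          using elim(1) \<delta> by (subst (asm) pos_divide_less_eq) auto
        then have "exp (ln (real ?N)) \<le> exp ((d + e/2) * (- ln \<delta>))" by simp
        then show ?thesis using False \<delta> by (simp add: powr_def algebra_simps)
      qed simp
      have "hausdorff_pre_measure s \<epsilon> E \<le> hausdorff_pre_measure s \<delta> E"
        using \<delta> by (intro hausdorff_pre_measure_antimono_scale) simp
      also have "\<dots> \<le> ennreal (real ?N * \<delta> powr s)"
        using cov s \<delta> by (intro hausdorff_pre_measure_le_covered) auto
      also have "\<dots> \<le> ennreal (\<delta> powr (- (d + e/2)) * \<delta> powr s)"
        using \<open>real ?N \<le> _\<close> by (intro ennreal_leI mult_right_mono) auto
      also have "\<delta> powr (- (d + e/2)) * \<delta> powr s = \<delta> powr (e/2)"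
        by (simp add: s_def flip: powr_add)
      finally show ?case .
    qed
    with lim have "hausdorff_pre_measure s \<epsilon> E \<le> ennreal 0"
      by (rule tendsto_lowerbound) (simp add: trivial_limit_at_right_real)
    then show ?thesis by simp
  qed
  have "hausdorff_measure s E = 0"
    unfolding hausdorff_measure_def by (simp add: pre)
  then have "hausdorff_dim E \<le> ennreal s"
    unfolding hausdorff_dim_def using s by (intro INF_lower) auto
  then show "hausdorff_dim E \<le> ennreal d + ennreal e"
    using d e by (simp add: s_def ennreal_plus)
qed

section \<open>Sets that project onto the unit square\<close>

text \<open>
  The projection of a set of diameter \<open>d\<close> lies in a square of side \<open>2 * d\<close> around the projection of
  any of its points; these squares cover the unit square, so their areas sum to at least \<open>1\<close>.
\<close>

lemma area_le_diam_sum: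
  fixes E :: "(real \<times> real \<times> real) set"
  assumes "delta_cover \<delta> E U"
    and E: "\<And>x y. x \<in> {0..1} \<Longrightarrow> y \<in> {0..1} \<Longrightarrow> \<exists>z. (x, y, z) \<in> E"
  shows "1 \<le> 4 * (\<Sum>i. diam_pow 2 (U i))"
proof -
  define Q where "Q i = (if U i = {} then {} else
     (let p = (SOME p. p \<in> U i); d = diameter (U i) in
      cbox (fst p - d, fst (snd p) - d) (fst p + d, fst (snd p) + d)))" for i
  have U: "bounded (U i)" for i using assms(1) by (simp add: delta_cover_def)
  have area: "emeasure lborel (Q i) = 4 * diam_pow 2 (U i)" for i
  proof (cases "U i = {}")
    case False
    have "0 \<le> diameter (U i)" using U by (rule diameter_ge_0)
    then show ?thesis using False
      by (simp add: Q_def diam_pow_def Let_def emeasure_lborel_cbox_eq Basis_prod_def inner_Pair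
            ennreal_mult power2_eq_square flip: ennreal_numeral)
  qed (simp add: Q_def diam_pow_def)
  have "cbox (0, 0) (1, 1) \<subseteq> (\<Union>i. Q i)"
  proof
    fix q :: "real \<times> real" assume "q \<in> cbox (0, 0) (1, 1)"
    then have "fst q \<in> {0..1}" "snd q \<in> {0..1}" by (auto simp: cbox_Pair_eq)
    then obtain z where "(fst q, snd q, z) \<in> E" using E by blast
    then obtain i where i: "(fst q, snd q, z) \<in> U i"
      using assms(1) by (auto simp: delta_cover_def)
    define p where "p = (SOME p. p \<in> U i)"
    have "p \<in> U i" unfolding p_def using i by (rule someI)
    then have d: "dist (fst q, snd q, z) p \<le> diameter (U i)"
      using diameter_bounded_bound[OF U i] by simp
    have "\<bar>fst q - fst p\<bar> \<le> dist (fst q, snd q, z) p"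
      using dist_fst_le[of "(fst q, snd q, z)" p] by (simp add: dist_real_def)
    moreover have "\<bar>snd q - fst (snd p)\<bar> \<le> dist (fst q, snd q, z) p"
      using dist_snd_le[of "(fst q, snd q, z)" p] dist_fst_le[of "(snd q, z)" "snd p"]
      by (simp add: dist_real_def)
    ultimately have "q \<in> Q i"
      using d i unfolding Q_def p_def[symmetric] Let_def
      by (auto simp: cbox_Pair_eq mem_Times_iff)
    then show "q \<in> (\<Union>i. Q i)" by blast
  qed
  then have "emeasure lborel (cbox (0, 0) (1, 1 :: real) :: (real \<times> real) set) \<le> emeasure lborel (\<Union>i. Q i)"
    by (rule emeasure_mono) (auto simp: Q_def Let_def)
  also have "\<dots> \<le> (\<Sum>i. emeasure lborel (Q i))"
    by (rule emeasure_subadditive_countably) (auto simp: Q_def Let_def)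
  finally show ?thesis
    by (simp add: area emeasure_lborel_cbox_eq Basis_prod_def inner_Pair)
qed

lemma hausdorff_pre_measure_over_square:
  fixes E :: "(real \<times> real \<times> real) set"
  assumes "\<And>x y. x \<in> {0..1} \<Longrightarrow> y \<in> {0..1} \<Longrightarrow> \<exists>z. (x, y, z) \<in> E"
  shows "ennreal (1/4) \<le> hausdorff_pre_measure 2 \<delta> E"
  unfolding hausdorff_pre_measure_def
proof (rule INF_greatest)
  fix U assume "U \<in> {U. delta_cover \<delta> E U}"
  then have "ennreal (1/4) * 1 \<le> ennreal (1/4) * (4 * (\<Sum>i. diam_pow 2 (U i)))"
    using assms by (intro mult_left_mono area_le_diam_sum) auto
  also have "\<dots> = ennreal (1/4) * ennreal 4 * (\<Sum>i. diam_pow 2 (U i))" by (simp add: mult.assoc)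
  also have "\<dots> = (\<Sum>i. diam_pow 2 (U i))" by (simp flip: ennreal_mult' ennreal_numeral)
  finally show "ennreal (1/4) \<le> (\<Sum>i. diam_pow 2 (U i))" by simp
qed

lemma hausdorff_dim_over_square:
  fixes E :: "(real \<times> real \<times> real) set"
  assumes "\<And>x y. x \<in> {0..1} \<Longrightarrow> y \<in> {0..1} \<Longrightarrow> \<exists>z. (x, y, z) \<in> E"
  shows "2 \<le> hausdorff_dim E"
  unfolding hausdorff_dim_def
proof (rule INF_greatest)
  fix s assume s: "s \<in> {s. 0 \<le> s \<and> hausdorff_measure s E = 0}"
  have "2 \<le> s"
  proof (rule ccontr)
    assume "\<not> 2 \<le> s"
    then have "ennreal (1/4) \<le> hausdorff_pre_measure s 1 E"
      using hausdorff_pre_measure_over_square[OF assms, of 1]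
        hausdorff_pre_measure_antimono_exponent[of s 2 1 E] s by (auto intro: order_trans)
    also have "\<dots> \<le> hausdorff_measure s E"
      unfolding hausdorff_measure_def by (intro SUP_upper) simp
    finally show False using s by simp
  qed
  then show "2 \<le> ennreal s" using ennreal_leI by fastforce
qed

lemma covering_number_over_square:
  fixes E :: "(real \<times> real \<times> real) set"
  assumes "\<And>x y. x \<in> {0..1} \<Longrightarrow> y \<in> {0..1} \<Longrightarrow> \<exists>z. (x, y, z) \<in> E"
    and "bounded E" "0 < \<delta>"
  shows "1/4 \<le> real (covering_number \<delta> E) * \<delta>\<^sup>2"
proof -
  have "covered_by (covering_number \<delta> E) \<delta> E"
    using bounded_covered_by[OF assms(2,3)] covered_by_covering_number by blast
  then have "ennreal (1/4) \<le> ennreal (real (covering_number \<delta> E) * \<delta> powr 2)"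
    using hausdorff_pre_measure_over_square[OF assms(1)] assms(3)
    by (intro order_trans[OF _ hausdorff_pre_measure_le_covered]) auto
  then show ?thesis using assms(3) by (subst (asm) ennreal_le_iff) auto
qed

text \<open>
  The hypothesis \<open>cov\<close> at the first scale \<open>D / 2 ^ n \<le> \<delta>\<close> bounds the covering number by
  a multiple of \<open>(log 2 (D / \<delta>) + 2) / \<delta>\<^sup>2\<close>; the logarithm is invisible to the box dimension.
\<close>

lemma has_box_dim_over_square:
  fixes E :: "(real \<times> real \<times> real) set"
  assumes proj: "\<And>x y. x \<in> {0..1} \<Longrightarrow> y \<in> {0..1} \<Longrightarrow> \<exists>z. (x, y, z) \<in> E"
    and bdd: "bounded E" and D: "0 < D"
    and cov: "\<And>n. covered_by ((n + 1) * (2 ^ n + 1)\<^sup>2) (D / 2 ^ n) E"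
  shows "has_box_dim E 2"
proof -
  let ?N = "\<lambda>\<delta>. real (covering_number \<delta> E)"
  let ?u = "\<lambda>\<delta>. (log 2 (D/\<delta>) + 2) * (4 * D/\<delta>)\<^sup>2"
  have low: "ln (1 / (4 * \<delta>\<^sup>2)) \<le> ln (?N \<delta>)" and up: "ln (?N \<delta>) \<le> ln (?u \<delta>)"
    if "0 < \<delta>" "\<delta> < D" for \<delta>
  proof -
    have *: "1 / (4 * \<delta>\<^sup>2) \<le> ?N \<delta>"
      using covering_number_over_square[OF proj bdd, of \<delta>] that by (simp add: field_simps)
    have pos: "0 < 1 / (4 * \<delta>\<^sup>2)" using that by simp
    show "ln (1 / (4 * \<delta>\<^sup>2)) \<le> ln (?N \<delta>)" using * pos by (subst ln_le_cancel_iff) linarith+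
    \<comment> \<open>Rounding up makes the scale \<open>D / 2 ^ n\<close> at most \<open>\<delta>\<close>, at the price of a factor \<open>2\<close>.\<close>
    define n where "n = nat \<lceil>log 2 (D/\<delta>)\<rceil>"
    have l: "0 < log 2 (D/\<delta>)" using that by (simp add: zero_less_log_cancel_iff)
    then have n: "log 2 (D/\<delta>) \<le> n" "n \<le> log 2 (D/\<delta>) + 1"
      unfolding n_def by linarith+
    have "D/\<delta> = 2 powr (log 2 (D/\<delta>))" using that D by simp
    also have "\<dots> \<le> 2 powr n" using n by simp
    finally have n1: "D / 2 ^ n \<le> \<delta>" using that by (simp add: powr_realpow field_simps)
    have "2 ^ n = 2 powr n" by (simp add: powr_realpow)
    also have "\<dots> \<le> 2 powr (log 2 (D/\<delta>) + 1)" using n by simp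
    also have "\<dots> = 2 * D/\<delta>" using that D by (simp add: powr_add)
    finally have n2: "(2::real) ^ n \<le> 2 * D/\<delta>" .
    have "?N \<delta> \<le> real ((n + 1) * (2 ^ n + 1)\<^sup>2)"
      using covered_by_mono[OF cov[of n] order_refl n1 order_refl] covering_number_le of_nat_le_iff by blast
    also have "\<dots> = (real n + 1) * (2 ^ n + 1)\<^sup>2" by (simp add: algebra_simps)
    also have "\<dots> \<le> (real n + 1) * (2 * 2 ^ n)\<^sup>2"
      by (intro mult_left_mono power_mono) auto
    also have "\<dots> \<le> ?u \<delta>"
      using n n2 l by (intro mult_mono power_mono) auto
    finally show "ln (?N \<delta>) \<le> ln (?u \<delta>)"
      using * pos by (subst ln_le_cancel_iff) linarith+
  qed
  have "((\<lambda>\<delta>. ln (?N \<delta>) / (- ln \<delta>)) \<longlongrightarrow> 2) (at_right 0)"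
  proof (rule tendsto_sandwich)
    have ev: "\<forall>\<^sub>F \<delta> in at_right (0::real). 0 < \<delta> \<and> \<delta> < D \<and> \<delta> < 1"
      using D eventually_at_right_less[of 0] eventually_at_right_real[of 0 D]  eventually_at_right_real[of 0 1]
      by (auto elim: eventually_elim2)
    show "\<forall>\<^sub>F \<delta> in at_right 0. ln (1 / (4 * \<delta>\<^sup>2)) / (- ln \<delta>) \<le> ln (?N \<delta>) / (- ln \<delta>)"
      using ev by eventually_elim (intro divide_right_mono low, auto)
    show "\<forall>\<^sub>F \<delta> in at_right 0. ln (?N \<delta>) / (- ln \<delta>) \<le> ln (?u \<delta>) / (- ln \<delta>)"
      using ev by eventually_elim (intro divide_right_mono up, auto)
    show "((\<lambda>\<delta>::real. ln (1 / (4 * \<delta>\<^sup>2)) / (- ln \<delta>)) \<longlongrightarrow> 2) (at_right 0)" by real_asymp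
    show "((\<lambda>\<delta>. ln (?u \<delta>) / (- ln \<delta>)) \<longlongrightarrow> 2) (at_right 0)" using D by real_asymp
  qed
  moreover have "E \<noteq> {}" using proj[of 0 0] by auto
  ultimately show ?thesis using bdd by (simp add: has_box_dim_def)
qed


section \<open>The function M\<close>

lemma M_fun_measurable: "(\<lambda>p. M_fun (fst p) (snd p)) \<in> borel_measurable borel"
proof -
  have [measurable]: "(\<lambda>p. G_piece n (fst p) (snd p)) \<in> borel_measurable (borel \<Otimes>\<^sub>M borel)" for n
    unfolding G_piece_def Theta_def Upsilon_def by (cases "n = 1") simp_all
  have [measurable]: "(\<lambda>p. F_glued n (fst p) (snd p)) \<in> borel_measurable (borel \<Otimes>\<^sub>M borel)" for n
    by (induction n rule: induct_nat_012) simp_all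
  have "(\<lambda>p. M_fun (fst p) (snd p)) \<in> borel_measurable (borel \<Otimes>\<^sub>M borel)"
    unfolding M_fun_def Theta_def by measurable
  then show ?thesis by (simp add: borel_prod)
qed

lemma M_fun_axis: "M_fun x 0 = 0" "M_fun 0 y = 0"
proof -
  show "M_fun 0 y = 0"
    using M_fun_eq[of 1 0 y] by (simp add: a_seq_eq G_piece_def Theta_def)
  have "F_glued n x 0 = 0" for n
    by (induction n rule: induct_nat_012) (simp_all add: G_piece_def Theta_def)
  then show "M_fun x 0 = 0" by (simp add: M_fun_def Theta_def)
qed

text \<open>
  The parameter \<open>t\<close> is \<^const>\<open>Upsilon\<close> at \<open>x\<close>; the strips are indexed from \<open>0\<close> here.
\<close>

lemma M_fun_strip:
  assumes "x \<in> {a_seq n..a_seq (Suc n)}"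
  obtains t where "t = 2 ^ n * (x - a_seq n)" "t \<in> {0..1/2}"
    "\<And>y. M_fun x y = 1 / real (Suc n) * (t * (t - 1/2)) * y"
proof
  show "2 ^ n * (x - a_seq n) \<in> {0..1/2}"
    using assms by (simp add: a_seq_Suc field_simps)
  show "M_fun x y = 1 / real (Suc n) * (2 ^ n * (x - a_seq n) * (2 ^ n * (x - a_seq n) - 1/2)) * y" for y
    using M_fun_eq[of "Suc n" x y] assms
    by (auto simp: G_piece_def Theta_def Upsilon_def a_seq_def)
qed simp

lemma strips_exhaust:
  assumes "x \<in> {0..<1}"
  obtains n where "x \<in> {a_seq n..a_seq (Suc n)}"
proof -
  obtain N where N: "(1/2) ^ N < 1 - x" using assms real_arch_pow_inv[of "1 - x" "1/2"] by auto
  define n where "n = (LEAST n. x \<le> a_seq (Suc n))"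
  have "(1/2::real) ^ Suc N \<le> (1/2) ^ N" by simp
  then have "x \<le> a_seq (Suc N)" using N by (simp add: a_seq_eq power_one_over)
  then have 1: "x \<le> a_seq (Suc n)" unfolding n_def by (rule LeastI)
  have "a_seq n \<le> x"
  proof (cases n)
    case 0
    then show ?thesis using assms by (simp add: a_seq_eq)
  next
    case (Suc k)
    then show ?thesis using not_less_Least[of k "\<lambda>n. x \<le> a_seq (Suc n)"] by (simp add: n_def)
  qed
  with 1 show ?thesis by (intro that) simp
qed

lemma M_fun_linear:
  assumes "x \<in> {0..1}"
  obtains c where "\<bar>c\<bar> \<le> 1" "\<And>y. M_fun x y = c * y"
proof (cases "x = 1")
  case False
  then obtain n where "x \<in> {a_seq n..a_seq (Suc n)}" using strips_exhaust[of x] assms by auto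
  then obtain t where t: "t \<in> {0..1/2}" and M: "\<And>y. M_fun x y = 1 / real (Suc n) * (t * (t - 1/2)) * y"
    by (rule M_fun_strip) blast
  have "\<bar>t * (t - 1/2)\<bar> \<le> 1 * 1"
    unfolding abs_mult using t by (intro mult_mono) auto
  then have "\<bar>1 / real (Suc n) * (t * (t - 1/2))\<bar> \<le> 1 * 1"
    by (subst abs_mult, intro mult_mono) auto
  then have "\<bar>1 / real (Suc n) * (t * (t - 1/2))\<bar> \<le> 1" by simp
  then show ?thesis using M by (rule that)
qed (use that[of 0] M_fun_1 in simp)

lemma M_fun_bounded:
  assumes "x \<in> {0..1}" "y \<in> {0..1}"
  shows "\<bar>M_fun x y\<bar> \<le> 1"
proof -
  obtain c where "\<bar>c\<bar> \<le> 1" "\<And>y. M_fun x y = c * y" using M_fun_linear assms(1) by blast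
  then show ?thesis using assms(2) mult_mono[of "\<bar>c\<bar>" 1 "\<bar>y\<bar>" 1] by (simp add: abs_mult)
qed

text \<open>
  On the strip that ends at \<open>a_seq (Suc n)\<close>, the factor \<open>2 ^ n\<close> comes from \<^const>\<open>Upsilon\<close>, and
  the difference quotient \<open>t + t' - 1/2\<close> of the parabola is at most \<open>1/2\<close> in absolute value.
  Estimates on both sides of a common boundary combine by passing through the boundary point.
\<close>

lemma M_fun_Lipschitz_x:
  assumes "x \<in> {0..a_seq n}" "x' \<in> {0..a_seq n}" "y \<in> {0..1}"
  shows "\<bar>M_fun x y - M_fun x' y\<bar> \<le> 2 ^ n * \<bar>x - x'\<bar>"
  using assms(1,2)
proof (induction n arbitrary: x x')
  case 0
  then show ?case by (simp add: a_seq_eq)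
next
  case (Suc n)
  have new: "\<bar>M_fun x y - M_fun x' y\<bar> \<le> 2 ^ Suc n * \<bar>x - x'\<bar>"
    if x: "x \<in> {a_seq n..a_seq (Suc n)}" and x': "x' \<in> {a_seq n..a_seq (Suc n)}" for x x'
  proof -
    obtain t where t: "t = 2 ^ n * (x - a_seq n)" "t \<in> {0..1/2}"
        and M: "M_fun x y = 1 / real (Suc n) * (t * (t - 1/2)) * y"
      using x by (rule M_fun_strip) blast
    obtain t' where t': "t' = 2 ^ n * (x' - a_seq n)" "t' \<in> {0..1/2}"
        and M': "M_fun x' y = 1 / real (Suc n) * (t' * (t' - 1/2)) * y"
      using x' by (rule M_fun_strip) blast
    have "M_fun x y - M_fun x' y = (1 / real (Suc n) * (t + t' - 1/2) * y) * (t - t')"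
      unfolding M M' by algebra
    also have "\<bar>\<dots>\<bar> \<le> (1 * 1 * 1) * \<bar>t - t'\<bar>"
      unfolding abs_mult using t t' assms(3) by (intro mult_mono) auto
    also have "\<dots> = 2 ^ n * \<bar>x - x'\<bar>"
      unfolding t t' by (simp add: abs_mult flip: right_diff_distrib)
    also have "\<dots> \<le> 2 ^ Suc n * \<bar>x - x'\<bar>" by (intro mult_right_mono) auto
    finally show ?thesis .
  qed
  have old: "\<bar>M_fun x y - M_fun x' y\<bar> \<le> 2 ^ Suc n * \<bar>x - x'\<bar>"
    if "x \<in> {0..a_seq n}" "x' \<in> {0..a_seq n}" for x x'
  proof -
    have "\<bar>M_fun x y - M_fun x' y\<bar> \<le> 2 ^ n * \<bar>x - x'\<bar>" using Suc.IH that .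
    also have "\<dots> \<le> 2 ^ Suc n * \<bar>x - x'\<bar>" by (intro mult_right_mono) auto
    finally show ?thesis .
  qed
  have mixed: "\<bar>M_fun x y - M_fun x' y\<bar> \<le> 2 ^ Suc n * \<bar>x - x'\<bar>"
    if x: "x \<in> {0..a_seq n}" and x': "x' \<in> {a_seq n..a_seq (Suc n)}" for x x'
  proof -
    have "\<bar>M_fun x y - M_fun x' y\<bar> \<le> \<bar>M_fun x y - M_fun (a_seq n) y\<bar> + \<bar>M_fun (a_seq n) y - M_fun x' y\<bar>"
      by simp
    also have "\<dots> \<le> 2 ^ Suc n * \<bar>x - a_seq n\<bar> + 2 ^ Suc n * \<bar>a_seq n - x'\<bar>"
      using x x' by (intro add_mono old new) auto
    also have "\<dots> = 2 ^ Suc n * \<bar>x - x'\<bar>"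
      using x x' by (simp add: algebra_simps)
    finally show ?thesis .
  qed
  consider "x \<le> a_seq n" "x' \<le> a_seq n" | "x \<le> a_seq n" "a_seq n \<le> x'"
    | "a_seq n \<le> x" "x' \<le> a_seq n" | "a_seq n \<le> x" "a_seq n \<le> x'" by linarith
  then show ?case
  proof cases
    case 3
    then show ?thesis using mixed[of x' x] Suc.prems by (simp add: abs_minus_commute)
  qed (use old new mixed Suc.prems in auto)
qed

lemma M_fun_Lipschitz:
  assumes "x \<in> {0..a_seq n}" "x' \<in> {0..a_seq n}" "y \<in> {0..1}" "y' \<in> {0..1}"
  shows "\<bar>M_fun x y - M_fun x' y'\<bar> \<le> 2 ^ n * \<bar>x - x'\<bar> + 1 * \<bar>y - y'\<bar>"
proof -
  have "x' \<in> {0..1}" using assms(2) by (auto simp: a_seq_eq intro: order_trans)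
  then obtain c where c: "\<bar>c\<bar> \<le> 1" "\<And>y. M_fun x' y = c * y" using M_fun_linear by blast
  have "\<bar>M_fun x' y - M_fun x' y'\<bar> \<le> 1 * \<bar>y - y'\<bar>"
    unfolding c(2) right_diff_distrib[symmetric] abs_mult using c(1) by (intro mult_right_mono) auto
  then show ?thesis using M_fun_Lipschitz_x[OF assms(1-3)] by linarith
qed

section \<open>The fractional integral as a convolution\<close>

lemma powr_kernel_integrable:
  assumes "-1 < (a::real)"
  shows "integrable lborel (\<lambda>s. indicator {0..1} s * s powr a)"
proof -
  have "(\<lambda>s. s powr a) absolutely_integrable_on {0..1}"
    using assms by (intro nonnegative_absolutely_integrable_1 integrable_on_powr_from_0) auto
  then have "integrable lebesgue (\<lambda>s. indicator {0..1} s * s powr a)"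
    by (simp add: set_integrable_def)
  then show ?thesis by (subst (asm) integrable_completion) auto
qed

definition RL_kernel :: "real \<Rightarrow> real \<Rightarrow> real \<times> real \<Rightarrow> real" where
  "RL_kernel \<gamma>1 \<gamma>2 = (\<lambda>(s, t).
     (indicator {0..1} s * s powr (\<gamma>1 - 1)) * (indicator {0..1} t * t powr (\<gamma>2 - 1)))"

lemma RL_kernel_nonneg: "0 \<le> RL_kernel \<gamma>1 \<gamma>2 q"
  by (simp add: RL_kernel_def split: prod.split)

lemma RL_kernel_integrable:
  assumes "0 < \<gamma>1" "0 < \<gamma>2"
  shows "integrable lborel (RL_kernel \<gamma>1 \<gamma>2)"
proof -
  note k = powr_kernel_integrable[of "\<gamma>1 - 1"] powr_kernel_integrable[of "\<gamma>2 - 1"]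
  have "integrable (lborel \<Otimes>\<^sub>M lborel) (RL_kernel \<gamma>1 \<gamma>2)"
  proof (rule pair_sigma_finite.Fubini_integrable)
    show "integrable lborel (\<lambda>s. \<integral>t. norm (RL_kernel \<gamma>1 \<gamma>2 (s, t)) \<partial>lborel)"
      using k assms by (simp add: RL_kernel_def abs_mult)
    show "AE s in lborel. integrable lborel (\<lambda>t. RL_kernel \<gamma>1 \<gamma>2 (s, t))"
      using k assms by (simp add: RL_kernel_def)
    show "RL_kernel \<gamma>1 \<gamma>2 \<in> borel_measurable (lborel \<Otimes>\<^sub>M lborel)"
      unfolding RL_kernel_def by measurable
  qed (unfold_locales)
  then show ?thesis by (simp add: lborel_prod)
qed

lemma lborel_reflect: "distr lborel borel (\<lambda>q. p - q) = (lborel :: 'a::euclidean_space measure)"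
  using lborel_affine[of "-1" p] by (simp add: density_1)

text \<open>
  The kernel lives on the whole unit square although the integral runs over \<open>[0, x] \<times> [0, y]\<close>
  only: for \<open>s > x\<close> or \<open>t > y\<close> the clamped argument lies on an axis, where \<open>f\<close> vanishes.  The
  domain of integration becomes independent of \<open>(x, y)\<close>, so integrals at different points can be
  subtracted under the integral sign.
\<close>

lemma RL_integrand_reflect:
  assumes "\<And>v. f 0 v = 0" "\<And>u. f u 0 = 0" "x \<in> {0..1}" "y \<in> {0..1}"
  shows "indicator ({0..x} \<times> {0..y}) ((x, y) - q) *\<^sub>R RL_integrand \<gamma>1 \<gamma>2 f x y ((x, y) - q)
       = RL_kernel \<gamma>1 \<gamma>2 q * f (max 0 (x - fst q)) (max 0 (y - snd q))"
  using assms by (cases q) (auto simp: RL_integrand_def RL_kernel_def indicator_def max_def)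

context
  fixes f :: "real \<Rightarrow> real \<Rightarrow> real" and B \<gamma>1 \<gamma>2 :: real
  assumes f0: "\<And>v. f 0 v = 0" "\<And>u. f u 0 = 0"
    and meas: "(\<lambda>p. f (fst p) (snd p)) \<in> borel_measurable borel"
    and bdd: "\<And>x y. x \<in> {0..1} \<Longrightarrow> y \<in> {0..1} \<Longrightarrow> \<bar>f x y\<bar> \<le> B"
    and \<gamma>: "0 < \<gamma>1" "0 < \<gamma>2"
begin

lemma RL_as_convolution:
  assumes x: "x \<in> {0..1}" and y: "y \<in> {0..1}"
  shows "integrable lborel (\<lambda>q. RL_kernel \<gamma>1 \<gamma>2 q * f (max 0 (x - fst q)) (max 0 (y - snd q)))"
    and "mixed_RL_finite \<gamma>1 \<gamma>2 f x y"
    and "mixed_RL \<gamma>1 \<gamma>2 f x y = 1 / (Gamma \<gamma>1 * Gamma \<gamma>2) *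
      (LINT q|lborel. RL_kernel \<gamma>1 \<gamma>2 q * f (max 0 (x - fst q)) (max 0 (y - snd q)))"
proof -
  let ?h = "\<lambda>p. indicator ({0..x} \<times> {0..y}) p *\<^sub>R RL_integrand \<gamma>1 \<gamma>2 f x y p"
  let ?k = "\<lambda>q. RL_kernel \<gamma>1 \<gamma>2 q * f (max 0 (x - fst q)) (max 0 (y - snd q))"
  have hk: "?h ((x, y) - q) = ?k q" for q
    by (rule RL_integrand_reflect) (use f0 x y in auto)
  have [measurable (raw)]: "(\<lambda>p. f (g p) (h p)) \<in> borel_measurable N"
    if "g \<in> borel_measurable N" "h \<in> borel_measurable N" for g h and N :: "(real \<times> real) measure"
    using measurable_compose[OF borel_measurable_Pair[OF that] meas] by simp
  have hm: "?h \<in> borel_measurable borel"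
    unfolding RL_integrand_def case_prod_beta borel_prod[symmetric] by measurable
  have km: "?k \<in> borel_measurable borel"
    unfolding RL_kernel_def case_prod_beta borel_prod[symmetric] by measurable
  show int: "integrable lborel ?k"
  proof (rule Bochner_Integration.integrable_bound)
    show "integrable lborel (\<lambda>q. B * RL_kernel \<gamma>1 \<gamma>2 q)"
      using RL_kernel_integrable[OF \<gamma>] by simp
    have "\<bar>?k q\<bar> \<le> B * RL_kernel \<gamma>1 \<gamma>2 q" for q
    proof (cases "RL_kernel \<gamma>1 \<gamma>2 q = 0")
      case False
      then have "fst q \<in> {0..1}" "snd q \<in> {0..1}"
        by (auto simp: RL_kernel_def indicator_def split: prod.splits if_splits)
      then have "\<bar>f (max 0 (x - fst q)) (max 0 (y - snd q))\<bar> \<le> B"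
        using x y by (intro bdd) auto
      then show ?thesis
        using RL_kernel_nonneg[of \<gamma>1 \<gamma>2 q]
        by (simp add: abs_mult mult.commute[of B] mult_left_mono)
    qed simp
    then show "AE q in lborel. norm (?k q) \<le> norm (B * RL_kernel \<gamma>1 \<gamma>2 q)"
      by (intro AE_I2) (simp only: real_norm_def order_trans[OF _ abs_ge_self])
  qed (use km in simp)
  have "integrable (distr lborel borel (\<lambda>q. (x, y) - q)) ?h \<longleftrightarrow> integrable lborel (\<lambda>q. ?h ((x, y) - q))"
    using hm by (intro integrable_distr_eq) auto
  then show "mixed_RL_finite \<gamma>1 \<gamma>2 f x y"
    using int by (simp only: mixed_RL_finite_def set_integrable_def lborel_reflect hk)
  have "integral\<^sup>L (distr lborel borel (\<lambda>q. (x, y) - q)) ?h = (LINT q|lborel. ?h ((x, y) - q))"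
    using hm by (intro integral_distr) auto
  then show "mixed_RL \<gamma>1 \<gamma>2 f x y = 1 / (Gamma \<gamma>1 * Gamma \<gamma>2) * (LINT q|lborel. ?k q)"
    by (simp only: mixed_RL_def set_lebesgue_integral_def lborel_reflect hk)
qed

text \<open>
  The fractional integral of the constant \<open>1\<close> at the corner \<open>(1, 1)\<close>.
\<close>

definition RL_const :: real where
  "RL_const = 1 / (Gamma \<gamma>1 * Gamma \<gamma>2) * (LINT q|lborel. RL_kernel \<gamma>1 \<gamma>2 q)"

lemma mixed_RL_bound:
  assumes int: "integrable lborel (\<lambda>q. RL_kernel \<gamma>1 \<gamma>2 q * g q)"
    and g: "\<And>q. fst q \<in> {0..1} \<Longrightarrow> snd q \<in> {0..1} \<Longrightarrow> \<bar>g q\<bar> \<le> R"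
  shows "\<bar>1 / (Gamma \<gamma>1 * Gamma \<gamma>2) * (LINT q|lborel. RL_kernel \<gamma>1 \<gamma>2 q * g q)\<bar> \<le> RL_const * R"
proof -
  have "\<bar>RL_kernel \<gamma>1 \<gamma>2 q * g q\<bar> \<le> RL_kernel \<gamma>1 \<gamma>2 q * R" for q
    using g[of q] RL_kernel_nonneg[of \<gamma>1 \<gamma>2 q]
    by (cases "fst q \<in> {0..1} \<and> snd q \<in> {0..1}")
       (auto simp: abs_mult mult_left_mono RL_kernel_def split: prod.splits)
  then have "\<bar>LINT q|lborel. RL_kernel \<gamma>1 \<gamma>2 q * g q\<bar> \<le> (LINT q|lborel. RL_kernel \<gamma>1 \<gamma>2 q * R)"
    using RL_kernel_integrable[OF \<gamma>] int
    by (intro order_trans[OF integral_abs_bound] integral_mono) auto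
  then have "1 / (Gamma \<gamma>1 * Gamma \<gamma>2) * \<bar>LINT q|lborel. RL_kernel \<gamma>1 \<gamma>2 q * g q\<bar>
      \<le> 1 / (Gamma \<gamma>1 * Gamma \<gamma>2) * (LINT q|lborel. RL_kernel \<gamma>1 \<gamma>2 q * R)"
    using \<gamma> by (intro mult_left_mono) (auto simp: Gamma_real_nonneg)
  then show ?thesis
    using \<gamma> by (simp add: RL_const_def abs_mult Gamma_real_pos less_imp_le)
qed

lemma mixed_RL_bounded:
  assumes "x \<in> {0..1}" "y \<in> {0..1}"
  shows "\<bar>mixed_RL \<gamma>1 \<gamma>2 f x y\<bar> \<le> RL_const * B"
  unfolding RL_as_convolution(3)[OF assms]
  using assms by (intro mixed_RL_bound RL_as_convolution(1) bdd) auto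

text \<open>
  Shifting \<open>(x, y)\<close> shifts the arguments of \<open>f\<close> under the integral by at most the same amount,
  because clamping is \<open>1\<close>-Lipschitz; the kernel has total mass \<^const>\<open>RL_const\<close> after normalisation.
  The bound on \<open>[0, a]\<close> only involves \<open>f\<close> on \<open>[0, a]\<close>, since arguments move to the left.
\<close>

lemma mixed_RL_Lipschitz:
  assumes lip: "\<And>u u' v v'. u \<in> {0..a} \<Longrightarrow> u' \<in> {0..a} \<Longrightarrow> v \<in> {0..1} \<Longrightarrow> v' \<in> {0..1} \<Longrightarrow>
      \<bar>f u v - f u' v'\<bar> \<le> K * \<bar>u - u'\<bar> + L * \<bar>v - v'\<bar>"
    and K: "0 \<le> K" and L: "0 \<le> L" and a: "a \<le> 1"
    and x: "x \<in> {0..a}" "x' \<in> {0..a}" and y: "y \<in> {0..1}" "y' \<in> {0..1}"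
  shows "\<bar>mixed_RL \<gamma>1 \<gamma>2 f x y - mixed_RL \<gamma>1 \<gamma>2 f x' y'\<bar> \<le> RL_const * (K * \<bar>x - x'\<bar> + L * \<bar>y - y'\<bar>)"
proof -
  let ?c = "1 / (Gamma \<gamma>1 * Gamma \<gamma>2)"
  let ?f = "\<lambda>x y q. f (max 0 (x - fst q)) (max 0 (y - snd q))"
  let ?g = "\<lambda>q. ?f x y q - ?f x' y' q"
  have x1: "x \<in> {0..1}" "x' \<in> {0..1}" using x a by auto
  note conv = RL_as_convolution[OF x1(1) y(1)] RL_as_convolution[OF x1(2) y(2)]
  have "mixed_RL \<gamma>1 \<gamma>2 f x y - mixed_RL \<gamma>1 \<gamma>2 f x' y'
      = ?c * ((LINT q|lborel. RL_kernel \<gamma>1 \<gamma>2 q * ?f x y q) - (LINT q|lborel. RL_kernel \<gamma>1 \<gamma>2 q * ?f x' y' q))"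
    unfolding conv(3,6) by (rule right_diff_distrib[symmetric])
  also have "\<dots> = ?c * (LINT q|lborel. RL_kernel \<gamma>1 \<gamma>2 q * ?f x y q - RL_kernel \<gamma>1 \<gamma>2 q * ?f x' y' q)"
    using conv(1,4) by (subst Bochner_Integration.integral_diff) auto
  finally have eq: "mixed_RL \<gamma>1 \<gamma>2 f x y - mixed_RL \<gamma>1 \<gamma>2 f x' y' = ?c * (LINT q|lborel. RL_kernel \<gamma>1 \<gamma>2 q * ?g q)"
    by (simp only: right_diff_distrib)
  have "\<bar>?c * (LINT q|lborel. RL_kernel \<gamma>1 \<gamma>2 q * ?g q)\<bar> \<le> RL_const * (K * \<bar>x - x'\<bar> + L * \<bar>y - y'\<bar>)"
  proof (rule mixed_RL_bound)
    show "integrable lborel (\<lambda>q. RL_kernel \<gamma>1 \<gamma>2 q * ?g q)"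
      using Bochner_Integration.integrable_diff[OF conv(1,4)] by (simp only: right_diff_distrib)
  next
    fix q :: "real \<times> real" assume q: "fst q \<in> {0..1}" "snd q \<in> {0..1}"
    have "\<bar>?g q\<bar> \<le> K * \<bar>max 0 (x - fst q) - max 0 (x' - fst q)\<bar> + L * \<bar>max 0 (y - snd q) - max 0 (y' - snd q)\<bar>"
      using q x y by (intro lip) auto
    also have "\<dots> \<le> K * \<bar>x - x'\<bar> + L * \<bar>y - y'\<bar>"
      using K L by (intro add_mono mult_left_mono) auto
    finally show "\<bar>?g q\<bar> \<le> K * \<bar>x - x'\<bar> + L * \<bar>y - y'\<bar>" .
  qed
  then show ?thesis by (simp only: eq)
qed

end


section \<open>The dimension of the graph\<close>

text \<open>
  Each strip is stretched to the unit square by \<open>x \<mapsto> 2 ^ Suc k * (x - a_seq k)\<close>; the width of the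
  strip and the Lipschitz constant on it cancel.  Beyond \<open>a_seq n\<close>, where no Lipschitz bound is
  available, \<open>x\<close> varies by at most the scale \<open>1 / 2 ^ n\<close>, and the points are parametrized by \<open>y\<close> and the height instead.
\<close>

lemma graph_covered_by:
  fixes F :: "real \<Rightarrow> real \<Rightarrow> real"
  assumes C: "1 \<le> C"
    and bdd: "\<And>x y. x \<in> {0..1} \<Longrightarrow> y \<in> {0..1} \<Longrightarrow> \<bar>F x y\<bar> \<le> C"
    and lip: "\<And>k x x' y y'. x \<in> {0..a_seq k} \<Longrightarrow> x' \<in> {0..a_seq k} \<Longrightarrow> y \<in> {0..1} \<Longrightarrow> y' \<in> {0..1} \<Longrightarrow>
      \<bar>F x y - F x' y'\<bar> \<le> C * (2 ^ k * \<bar>x - x'\<bar> + \<bar>y - y'\<bar>)"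
  shows "covered_by ((n + 1) * (2 ^ n + 1)\<^sup>2) (3 * (4 * C) / 2 ^ n) (Gr F)"
proof -
  let ?d = "3 * (4 * C) / real (2 ^ n)" and ?N = "(2 ^ n + 1)\<^sup>2 :: nat"
  define E where "E I = {(x, y, F x y) | x y. x \<in> I \<and> y \<in> {0..1}}" for I
  have dist3: "dist (x, y, z) (x', y', z') \<le> \<bar>x - x'\<bar> + \<bar>y - y'\<bar> + \<bar>z - z'\<bar>" for x y z x' y' z' :: real
    using sqrt_sum_squares_le_sum_abs[of "dist x x'" "dist (y, z) (y', z')"]
      sqrt_sum_squares_le_sum_abs[of "dist y y'" "dist z z'"]
    by (simp add: dist_Pair_Pair dist_real_def)
  have strip: "covered_by ?N ?d (E {a_seq k..a_seq (Suc k)})" for k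
  proof (rule covered_by_grid)
    let ?p = "\<lambda>e :: real \<times> real \<times> real. (2 ^ Suc k * (fst e - a_seq k), fst (snd e))"
    show "?p ` E {a_seq k..a_seq (Suc k)} \<subseteq> {0..1} \<times> {0..1}"
      by (auto simp: E_def a_seq_Suc field_simps)
    fix e e' assume "e \<in> E {a_seq k..a_seq (Suc k)}" "e' \<in> E {a_seq k..a_seq (Suc k)}"
    then obtain x y x' y' where e: "e = (x, y, F x y)" "e' = (x', y', F x' y')"
      and y: "y \<in> {0..1}" "y' \<in> {0..1}"
      and x: "x \<in> {a_seq k..a_seq (Suc k)}" "x' \<in> {a_seq k..a_seq (Suc k)}"
      by (auto simp: E_def)
    define s w where "s = 2 ^ Suc k * \<bar>x - x'\<bar>" and "w = s + \<bar>y - y'\<bar>"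
    have "0 \<le> a_seq k" by (simp add: a_seq_eq)
    then have z: "\<bar>F x y - F x' y'\<bar> \<le> C * w"
      using x y unfolding s_def w_def by (intro lip) auto
    have "1 * \<bar>x - x'\<bar> \<le> s" unfolding s_def by (intro mult_right_mono one_le_power) auto
    then have "dist e e' \<le> 1 * w + C * w"
      using dist3[of x y "F x y" x' y' "F x' y'"] z unfolding e w_def[symmetric] by (simp add: w_def)
    also have "\<dots> \<le> (3 * C) * w + C * w"
      using C by (intro add_mono mult_right_mono) (auto simp: s_def w_def)
    also have "\<dots> \<le> 4 * C * (s + \<bar>y - y'\<bar> + 1 / real (2 ^ n))"
      using C by (simp add: w_def distrib_left)
    also have "s = \<bar>2 ^ Suc k * (x - a_seq k) - 2 ^ Suc k * (x' - a_seq k)\<bar>"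
      by (simp add: s_def abs_mult flip: right_diff_distrib)
    finally show "dist e e' \<le> 4 * C * (\<bar>fst (?p e) - fst (?p e')\<bar> + \<bar>snd (?p e) - snd (?p e')\<bar> + 1 / real (2 ^ n))"
      by (simp add: e)
  qed (use C in auto)
  \<comment> \<open>Half-open intervals make the case \<open>k = 0\<close> empty.\<close>
  have left: "covered_by (k * ?N) ?d (E {0..<a_seq k})" for k
  proof (induction k)
    case 0
    have "E {0..<a_seq 0} = {}" by (simp add: E_def a_seq_eq)
    then show ?case using covered_by_empty by simp
  next
    case (Suc k)
    from covered_by_Un[OF strip[of k] Suc]
    show ?case
      by (rule covered_by_mono) (auto simp: E_def)
  qed
  have slab: "covered_by ?N ?d (E {a_seq n..1})"
  proof (rule covered_by_grid)
    let ?p = "\<lambda>e :: real \<times> real \<times> real. (fst (snd e), (snd (snd e) + C) / (2 * C))"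
    have a: "0 \<le> a_seq n" by (simp add: a_seq_eq)
    have "0 \<le> F x y + C \<and> F x y + C \<le> 2 * C" if "x \<in> {a_seq n..1}" "y \<in> {0..1}" for x y
      using bdd[of x y] that a by auto
    then show "?p ` E {a_seq n..1} \<subseteq> {0..1} \<times> {0..1}"
      using C by (auto simp: E_def)
    fix e e' assume "e \<in> E {a_seq n..1}" "e' \<in> E {a_seq n..1}"
    then obtain x y x' y' where e: "e = (x, y, F x y)" "e' = (x', y', F x' y')"
      and x: "x \<in> {a_seq n..1}" "x' \<in> {a_seq n..1}"
      by (auto simp: E_def)
    define t where "t = \<bar>F x y - F x' y'\<bar> / (2 * C)"
    have t: "\<bar>F x y - F x' y'\<bar> = (2 * C) * t" "0 \<le> t" using C by (auto simp: t_def)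
    have "\<bar>x - x'\<bar> \<le> 1 / real (2 ^ n)" using x by (auto simp: a_seq_eq)
    then have "dist e e' \<le> 1 * (1 / real (2 ^ n)) + 1 * \<bar>y - y'\<bar> + (2 * C) * t"
      using dist3[of x y "F x y" x' y' "F x' y'"] unfolding e t(1)[symmetric] by simp
    also have "\<dots> \<le> (4 * C) * (1 / real (2 ^ n)) + (4 * C) * \<bar>y - y'\<bar> + (4 * C) * t"
      using C t by (intro add_mono mult_right_mono) auto
    also have "\<dots> = 4 * C * (\<bar>y - y'\<bar> + t + 1 / real (2 ^ n))" by (simp add: algebra_simps)
    also have "t = \<bar>(F x y + C) / (2 * C) - (F x' y' + C) / (2 * C)\<bar>"
      using C by (simp add: t_def abs_divide flip: diff_divide_distrib)
    finally show "dist e e' \<le> 4 * C * (\<bar>fst (?p e) - fst (?p e')\<bar> + \<bar>snd (?p e) - snd (?p e')\<bar> + 1 / real (2 ^ n))"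
      by (simp add: e)
  qed (use C in auto)
  have "covered_by (?N + n * ?N) ?d (Gr F)"
    using covered_by_Un[OF slab left[of n]]
    by (rule covered_by_mono) (auto simp: E_def Gr_def)
  then show ?thesis by (simp add: algebra_simps)
qed

theorem theorem6p2:
  fixes \<gamma>1 \<gamma>2 :: real
  assumes "0 < \<gamma>1" "\<gamma>1 < 1" "0 < \<gamma>2" "\<gamma>2 < 1"
  shows "(\<forall>x\<in>{0..1}. \<forall>y\<in>{0..1}. mixed_RL_finite \<gamma>1 \<gamma>2 M_fun x y) \<and>
         hausdorff_dim (Gr (mixed_RL \<gamma>1 \<gamma>2 M_fun)) = 2 \<and>
         has_box_dim (Gr (mixed_RL \<gamma>1 \<gamma>2 M_fun)) 2"
proof -
  let ?F = "mixed_RL \<gamma>1 \<gamma>2 M_fun"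
  define C where "C = max 1 (RL_const \<gamma>1 \<gamma>2)"
  note RL = M_fun_axis(2,1) M_fun_measurable M_fun_bounded assms(1,3)
  have C: "1 \<le> C" "RL_const \<gamma>1 \<gamma>2 \<le> C" by (simp_all add: C_def)
  have bdd: "\<bar>?F x y\<bar> \<le> C" if "x \<in> {0..1}" "y \<in> {0..1}" for x y
    using mixed_RL_bounded[OF RL that] C by simp
  have lip: "\<bar>?F x y - ?F x' y'\<bar> \<le> C * (2 ^ k * \<bar>x - x'\<bar> + \<bar>y - y'\<bar>)"
    if "x \<in> {0..a_seq k}" "x' \<in> {0..a_seq k}" "y \<in> {0..1}" "y' \<in> {0..1}" for k x x' y y'
  proof -
    have "\<bar>?F x y - ?F x' y'\<bar> \<le> RL_const \<gamma>1 \<gamma>2 * (2 ^ k * \<bar>x - x'\<bar> + 1 * \<bar>y - y'\<bar>)"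
      using that by (intro mixed_RL_Lipschitz[where a = "a_seq k", OF RL] M_fun_Lipschitz) (auto simp: a_seq_eq)
    also have "\<dots> \<le> C * (2 ^ k * \<bar>x - x'\<bar> + 1 * \<bar>y - y'\<bar>)"
      using C by (intro mult_right_mono) auto
    finally show ?thesis by simp
  qed
  have cov: "covered_by ((n + 1) * (2 ^ n + 1)\<^sup>2) (3 * (4 * C) / 2 ^ n) (Gr ?F)" for n
    using C(1) bdd lip by (rule graph_covered_by)
  have "Gr ?F \<subseteq> {0..1} \<times> {0..1} \<times> {-C..C}"
    using bdd by (fastforce simp: Gr_def abs_le_iff)
  then have "bounded (Gr ?F)"
    by (rule bounded_subset[rotated]) (intro bounded_Times bounded_closed_interval)
  moreover have proj: "\<exists>z. (x, y, z) \<in> Gr ?F" if "x \<in> {0..1}" "y \<in> {0..1}" for x y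
    using that by (auto simp: Gr_def)
  ultimately have box: "has_box_dim (Gr ?F) 2"
    using C(1) cov by (intro has_box_dim_over_square[where D = "3 * (4 * C)"]) auto
  have "hausdorff_dim (Gr ?F) = 2"
    using hausdorff_dim_le_box_dim[OF box] hausdorff_dim_over_square[of "Gr ?F"] proj
    by (intro antisym) auto
  moreover have "mixed_RL_finite \<gamma>1 \<gamma>2 M_fun x y" if "x \<in> {0..1}" "y \<in> {0..1}" for x y
    using RL_as_convolution(2)[OF RL that] .
  ultimately show ?thesis using box by blast
qed

end
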